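(* Let $n,m\ge1$ and $d\ge 1$ be integers and let $y=(y_{(\alpha,\beta)})_{(\alpha,\beta)\in\mathbb{N}^n\times\mathbb{N}^m}$ be a real multi-sequence whose moment matrix $M_d(y)$ is positive definite. Then the zero in the inverse condition $(V)_r$ holds for every integer $r$ with $1\le r\le d$ if and only if condition $(O)_d$ holds, i.e. if and only if the orthonormal polynomials associated with $y$ satisfy the conditional triangularity with respect to $X$.
   Context: Variables: $X=(x_1,\dots,x_n)$, $Y=(y_1,\dots,y_m)$; indices $(\alpha,\beta)\in\mathbb{N}^n\times\mathbb{N}^m$ correspond to monomials $X^\alpha Y^\beta$, and $|(\alpha,\beta)|=|\alpha|+|\beta|$ is the total degree. $L_y:\mathbb{R}[X,Y]\to\mathbb{R}$ is the linear functional with $L_y(X^\alpha Y^\beta)=y_{(\alpha,\beta)}$. For $r\le d$, $M_r(y)$ is the matrix indexed by the $(\alpha,\beta)$ with $|(\alpha,\beta)|\le r$, with entries $M_r(y)((\alpha,\beta),(\alpha',\beta'))=y_{(\alpha+\alpha',\beta+\beta')}$. Orders. $\le$ on $\mathbb{N}^m$ is the componentwise order and $\max(\beta,\beta')$ is the componentwise maximum. On a single tuple space $\mathbb{N}^k$ the graded lexicographic order $<_{\mathrm{gl}}$ is the total order comparing degrees first and breaking ties as a dictionary would (with $X_1=a$, $X_2=b,\dots$; thus $1,X_1,X_2,X_1^2,X_1X_2,X_2^2$ is the increasing list for $k=2$ up to degree 2). On $\mathbb{N}^n\times\mathbb{N}^m$ the graded order $<_{\mathrm{gl}}$ respecting the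 grouping is: $(\alpha',\beta')<_{\mathrm{gl}}(\alpha,\beta)$ iff $|(\alpha',\beta')|<|(\alpha,\beta)|$, or the total degrees are equal and either $\alpha'<_{\mathrm{gl}}\alpha$, or $\alpha'=\alpha$ and $\beta'<_{\mathrm{gl}}\beta$. (So among indices of a fixed total degree listed in decreasing order, $|\alpha|$ is nonincreasing and $|\beta|$ is nondecreasing.) Orthonormal polynomials. With $\langle f,g\rangle_y=L_y(fg)$, an inner product on polynomials of degree at most $d$, the polynomials $p_{(\alpha,\beta)}$, $|(\alpha,\beta)|\le d$, are those obtained by Gram–Schmidt along $<_{\mathrm{gl}}$: $p_{(\alpha,\beta)}=\sum_{(\alpha',\beta')\le_{\mathrm{gl}}(\alpha,\beta)}\rho_{(\alpha,\beta),(\alpha',\beta')}X^{\alpha'}Y^{\beta'}$, they are orthonormal for $\langle\cdot,\cdot\rangle_y$, and $\langle p_{(\alpha,\beta)},X^\alpha Y^\beta\rangle_y>0$. Condition $(O)_d$ (conditional triangularity with respect to $X$): whenever $|(\alpha,\beta)|\le d$, $(\alpha',\beta')\le_{\mathrm{gl}}(\alpha,\beta)$ and $\beta'\not\le\beta$, one has $\rho_{(\alpha,\beta),(\alpha',\beta')}=0$. Condition $(V)_r$ (zero in the inverse): let $z_{(\alpha,\beta),(\alpha',\beta')}$ denote the entries of $M_r(y)^{-1}$. For all $(\alpha',\beta')\le_{\mathrm{gl}}(\alpha,\beta)$ with $|(\alpha,\beta)|\le r$: if every $(\gamma,\sigma)$ satisfying $(\gamma,\sigma)\ge_{\mathrm{gl}}(\alpha,\beta)$,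 $(\gamma,\sigma)\ge_{\mathrm{gl}}(\alpha',\beta')$ and $\sigma\ge\max(\beta,\beta')$ has $|(\gamma,\sigma)|>r$, then $z_{(\alpha,\beta),(\alpha',\beta')}=0$. *)

theory Defs
  imports "HOL-Analysis.Analysis" "HOL-Library.Poly_Mapping"
begin

text \<open>
  Exponents \<open>(\<alpha>, \<beta>) \<in> \<nat>\<^sup>n \<times> \<nat>\<^sup>m\<close> are elements of \<open>(nat ^ 'n) \<times> (nat ^ 'm)\<close> with \<open>n = CARD('n) \<ge> 1\<close>
  and \<open>m = CARD('m) \<ge> 1\<close>; the linear order on the index types is the numbering of the variables.
  A polynomial in \<open>\<real>[X, Y]\<close> is a finitely supported function from exponents to coefficients, so its
  ring operations are those of \<^theory>\<open>HOL-Library.Poly_Mapping\<close>.  On \<open>nat ^ 'm\<close> the relation \<open>\<le>\<close> is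
  the componentwise order.
\<close>

type_synonym ('n, 'm) expo = "(nat, 'n) vec \<times> (nat, 'm) vec"
type_synonym ('n, 'm) rpoly = "('n, 'm) expo \<Rightarrow>\<^sub>0 real"


subsection \<open>Degrees and graded lexicographic orders\<close>

definition vdeg :: "nat ^ 'k::finite \<Rightarrow> nat" where
  "vdeg \<alpha> = (\<Sum>i\<in>UNIV. \<alpha> $ i)"

definition tdeg :: "('n::finite, 'm::finite) expo \<Rightarrow> nat" where
  "tdeg a = vdeg (fst a) + vdeg (snd a)"

definition expos_upto :: "nat \<Rightarrow> ('n::finite, 'm::finite) expo set" where
  "expos_upto r = {a. tdeg a \<le> r}"

text \<open>
  The tie is broken as in a dictionary with \<open>X\<^sub>1 = a, X\<^sub>2 = b, \<dots>\<close>: of two monomials of equal degree,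
  the smaller one has the \<^emph>\<open>larger\<close> exponent at the first variable where they differ
  (\<open>X\<^sub>1\<^sup>2 < X\<^sub>1X\<^sub>2 < X\<^sub>2\<^sup>2\<close>).
\<close>

definition gl_less_vec :: "nat ^ 'k::{finite,linorder} \<Rightarrow> nat ^ 'k::{finite,linorder} \<Rightarrow> bool" where
  "gl_less_vec \<alpha>' \<alpha> \<longleftrightarrow>
     vdeg \<alpha>' < vdeg \<alpha> \<or>
     vdeg \<alpha>' = vdeg \<alpha> \<and> (\<exists>i. (\<forall>j<i. \<alpha>' $ j = \<alpha> $ j) \<and> \<alpha>' $ i > \<alpha> $ i)"

definition gl_less ::
    "('n::{finite,linorder}, 'm::{finite,linorder}) expo \<Rightarrow> ('n, 'm) expo \<Rightarrow> bool"
    (infix \<open><\<^sub>g\<^sub>l\<close> 50) where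
  "a' <\<^sub>g\<^sub>l a \<longleftrightarrow>
     tdeg a' < tdeg a \<or>
     tdeg a' = tdeg a \<and>
       (gl_less_vec (fst a') (fst a) \<or> fst a' = fst a \<and> gl_less_vec (snd a') (snd a))"

definition gl_le ::
    "('n::{finite,linorder}, 'm::{finite,linorder}) expo \<Rightarrow> ('n, 'm) expo \<Rightarrow> bool"
    (infix \<open>\<le>\<^sub>g\<^sub>l\<close> 50) where
  "a' \<le>\<^sub>g\<^sub>l a \<longleftrightarrow> a' <\<^sub>g\<^sub>l a \<or> a' = a"


subsection \<open>Matrices indexed by a finite set\<close>

definition pos_def_on :: "'i set \<Rightarrow> ('i \<Rightarrow> 'i \<Rightarrow> real) \<Rightarrow> bool" where
  "pos_def_on I A \<longleftrightarrow>
     (\<forall>i\<in>I. \<forall>j\<in>I. A i j = A j i) \<and>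
     (\<forall>v. (\<exists>i\<in>I. v i \<noteq> 0) \<longrightarrow> (\<Sum>i\<in>I. \<Sum>j\<in>I. v i * A i j * v j) > 0)"

text \<open>The inverse is normalised to vanish outside \<open>I \<times> I\<close>, which makes it unique as a function.\<close>

definition is_inverse_on :: "'i set \<Rightarrow> ('i \<Rightarrow> 'i \<Rightarrow> real) \<Rightarrow> ('i \<Rightarrow> 'i \<Rightarrow> real) \<Rightarrow> bool" where
  "is_inverse_on I A Z \<longleftrightarrow>
     (\<forall>i j. i \<notin> I \<or> j \<notin> I \<longrightarrow> Z i j = 0) \<and>
     (\<forall>i\<in>I. \<forall>j\<in>I. (\<Sum>k\<in>I. A i k * Z k j) = (if i = j then 1 else 0)) \<and>
     (\<forall>i\<in>I. \<forall>j\<in>I. (\<Sum>k\<in>I. Z i k * A k j) = (if i = j then 1 else 0))"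

definition inverse_on :: "'i set \<Rightarrow> ('i \<Rightarrow> 'i \<Rightarrow> real) \<Rightarrow> 'i \<Rightarrow> 'i \<Rightarrow> real" where
  "inverse_on I A = (THE Z. is_inverse_on I A Z)"

subsection \<open>Moments and orthonormal polynomials\<close>

definition riesz :: "(('n::finite, 'm::finite) expo \<Rightarrow> real) \<Rightarrow> ('n, 'm) rpoly \<Rightarrow> real" where
  "riesz y p = (\<Sum>a\<in>Poly_Mapping.keys p. Poly_Mapping.lookup p a * y a)"

definition pinner ::
    "(('n::finite, 'm::finite) expo \<Rightarrow> real) \<Rightarrow> ('n, 'm) rpoly \<Rightarrow> ('n, 'm) rpoly \<Rightarrow> real" where
  "pinner y f g = riesz y (f * g)"

text \<open>\<open>M\<^sub>r(y)\<close> is this kernel restricted to the index set \<^const>\<open>expos_upto\<close>\<open> r\<close>.\<close>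

definition moment_matrix ::
    "(('n::finite, 'm::finite) expo \<Rightarrow> real) \<Rightarrow> ('n, 'm) expo \<Rightarrow> ('n, 'm) expo \<Rightarrow> real" where
  "moment_matrix y a b = y (a + b)"

abbreviation xmon :: "('n::finite, 'm::finite) expo \<Rightarrow> ('n, 'm) rpoly" where
  "xmon a \<equiv> Poly_Mapping.single a 1"

abbreviation pscale :: "real \<Rightarrow> ('n::finite, 'm::finite) rpoly \<Rightarrow> ('n, 'm) rpoly" where
  "pscale c p \<equiv> Poly_Mapping.single 0 c * p"

lemma vdeg_component_le: "\<alpha> $ i \<le> vdeg \<alpha>"
  unfolding vdeg_def by (rule member_le_sum) auto

lemma finite_vdeg_le: "finite {\<alpha> :: nat ^ 'k::finite. vdeg \<alpha> \<le> r}"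
proof -
  have "finite {f. \<forall>i::'k. f i \<in> {..r}}"
    using finite_set_of_finite_funs[of "UNIV :: 'k set" "{..r}" 0] by simp
  then have "finite (vec_lambda ` {f. \<forall>i::'k. f i \<in> {..r}})"
    by simp
  moreover have "{\<alpha> :: nat ^ 'k. vdeg \<alpha> \<le> r} \<subseteq> vec_lambda ` {f. \<forall>i. f i \<in> {..r}}"
  proof
    fix \<alpha> :: "nat ^ 'k"
    assume "\<alpha> \<in> {\<alpha>. vdeg \<alpha> \<le> r}"
    then have "\<forall>i. \<alpha> $ i \<in> {..r}"
      using vdeg_component_le le_trans by (metis atMost_iff mem_Collect_eq)
    then show "\<alpha> \<in> vec_lambda ` {f. \<forall>i. f i \<in> {..r}}"
      by (intro image_eqI[of _ _ "vec_nth \<alpha>"]) auto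
  qed
  ultimately show ?thesis by (rule rev_finite_subset)
qed

lemma finite_expos_upto: "finite (expos_upto r :: ('n::finite, 'm::finite) expo set)"
proof (rule finite_subset)
  show "(expos_upto r :: ('n, 'm) expo set) \<subseteq> {\<alpha>. vdeg \<alpha> \<le> r} \<times> {\<beta>. vdeg \<beta> \<le> r}"
    by (auto simp: expos_upto_def tdeg_def)
qed (intro finite_cartesian_product finite_vdeg_le)

lemma gl_less_vec_irrefl: "\<not> gl_less_vec \<alpha> \<alpha>"
  by (simp add: gl_less_vec_def)

lemma gl_less_vec_trans:
  assumes "gl_less_vec \<alpha> \<beta>" "gl_less_vec \<beta> \<gamma>"
  shows "gl_less_vec \<alpha> \<gamma>"
proof (cases "vdeg \<alpha> < vdeg \<gamma>")
  case True
  then show ?thesis by (simp add: gl_less_vec_def)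
next
  case False
  then have eq: "vdeg \<alpha> = vdeg \<beta>" "vdeg \<beta> = vdeg \<gamma>"
    using assms by (auto simp: gl_less_vec_def)
  obtain i where i: "\<forall>j<i. \<alpha> $ j = \<beta> $ j" "\<alpha> $ i > \<beta> $ i"
    using assms(1) eq by (auto simp: gl_less_vec_def)
  obtain k where k: "\<forall>j<k. \<beta> $ j = \<gamma> $ j" "\<beta> $ k > \<gamma> $ k"
    using assms(2) eq by (auto simp: gl_less_vec_def)
  have "(\<forall>j<min i k. \<alpha> $ j = \<gamma> $ j) \<and> \<alpha> $ (min i k) > \<gamma> $ (min i k)"
    using i k by (cases i k rule: linorder_cases) (auto simp: min_def)
  then have "\<exists>l. (\<forall>j<l. \<alpha> $ j = \<gamma> $ j) \<and> \<alpha> $ l > \<gamma> $ l" by (rule exI[of _ "min i k"])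
  then show ?thesis using eq unfolding gl_less_vec_def by simp
qed

lemma gl_less_vec_total:
  fixes \<alpha> \<beta> :: "nat ^ 'k::{finite,linorder}"
  assumes "\<alpha> \<noteq> \<beta>"
  shows "gl_less_vec \<alpha> \<beta> \<or> gl_less_vec \<beta> \<alpha>"
proof (cases "vdeg \<alpha> = vdeg \<beta>")
  case False
  then show ?thesis by (auto simp: gl_less_vec_def)
next
  case True
  define D where "D = {i. \<alpha> $ i \<noteq> \<beta> $ i}"
  have "D \<noteq> {}" using assms by (auto simp: D_def vec_eq_iff)
  then have mem: "Min D \<in> D" by simp
  have eq: "\<alpha> $ j = \<beta> $ j" if "j < Min D" for j
  proof (rule ccontr)
    assume "\<not> ?thesis"
    then have "Min D \<le> j" by (intro Min_le) (auto simp: D_def)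
    then show False using that by simp
  qed
  have "\<alpha> $ Min D > \<beta> $ Min D \<or> \<beta> $ Min D > \<alpha> $ Min D"
    using mem unfolding D_def by auto
  then show ?thesis
  proof
    assume "\<alpha> $ Min D > \<beta> $ Min D"
    then have "\<exists>i. (\<forall>j<i. \<alpha> $ j = \<beta> $ j) \<and> \<alpha> $ i > \<beta> $ i"
      by (intro exI[of _ "Min D"]) (simp add: eq)
    then show ?thesis using True by (simp add: gl_less_vec_def)
  next
    assume "\<beta> $ Min D > \<alpha> $ Min D"
    then have "\<exists>i. (\<forall>j<i. \<beta> $ j = \<alpha> $ j) \<and> \<beta> $ i > \<alpha> $ i"
      by (intro exI[of _ "Min D"]) (simp add: eq)
    then show ?thesis using True by (simp add: gl_less_vec_def)
  qed
qed

lemma gl_less_irrefl: "\<not> a <\<^sub>g\<^sub>l a"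
  by (simp add: gl_less_def gl_less_vec_irrefl)

lemma gl_less_trans: "a <\<^sub>g\<^sub>l b \<Longrightarrow> b <\<^sub>g\<^sub>l c \<Longrightarrow> a <\<^sub>g\<^sub>l c"
  unfolding gl_less_def by (auto intro: gl_less_vec_trans)

lemma gl_less_total: "a \<noteq> b \<Longrightarrow> a <\<^sub>g\<^sub>l b \<or> b <\<^sub>g\<^sub>l a"
  using gl_less_vec_total[of "fst a" "fst b"] gl_less_vec_total[of "snd a" "snd b"]
  unfolding gl_less_def prod_eq_iff
  by (cases "tdeg a" "tdeg b" rule: linorder_cases; cases "fst a = fst b") auto

lemma gl_less_tdeg: "a <\<^sub>g\<^sub>l b \<Longrightarrow> tdeg a \<le> tdeg b"
  by (auto simp: gl_less_def)

lemma gl_le_tdeg: "a \<le>\<^sub>g\<^sub>l b \<Longrightarrow> tdeg a \<le> tdeg b"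
  by (auto simp: gl_le_def dest: gl_less_tdeg)

lemma gl_le_upto:
  assumes "tdeg a \<le> d"
  shows "{b. b \<le>\<^sub>g\<^sub>l a} \<subseteq> expos_upto d"
proof
  fix b
  assume "b \<in> {b. b \<le>\<^sub>g\<^sub>l a}"
  then have "tdeg b \<le> tdeg a" by (simp add: gl_le_tdeg)
  then show "b \<in> expos_upto d" using assms by (simp add: expos_upto_def)
qed

lemma finite_gl_below: "finite {b. b <\<^sub>g\<^sub>l a}"
  by (rule finite_subset[OF _ finite_expos_upto[of "tdeg a"]])
     (auto simp: expos_upto_def dest: gl_less_tdeg)

lemma wf_gl_less: "wf {(a, b). a <\<^sub>g\<^sub>l b}"
proof (rule wf_subset)
  show "wf (inv_image less_than (\<lambda>a. card {b. b <\<^sub>g\<^sub>l a}))"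
    by (rule wf_inv_image[OF wf_less_than])
  show "{(a, b). a <\<^sub>g\<^sub>l b} \<subseteq> inv_image less_than (\<lambda>a. card {b. b <\<^sub>g\<^sub>l a})"
  proof
    fix p
    assume "p \<in> {(a, b). a <\<^sub>g\<^sub>l b}"
    then obtain a b where p: "p = (a, b)" "a <\<^sub>g\<^sub>l b" by (cases p) simp
    have "{c. c <\<^sub>g\<^sub>l a} \<subset> {c. c <\<^sub>g\<^sub>l b}"
      using p(2) gl_less_trans gl_less_irrefl by blast
    then have "card {c. c <\<^sub>g\<^sub>l a} < card {c. c <\<^sub>g\<^sub>l b}"
      by (rule psubset_card_mono[OF finite_gl_below])
    then show "p \<in> inv_image less_than (\<lambda>a. card {b. b <\<^sub>g\<^sub>l a})"
      by (simp add: p)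
  qed
qed

text \<open>
  Gram--Schmidt along \<open><\<^sub>g\<^sub>l\<close>, applied to the monomials.  When \<open>M\<^sub>d(y)\<close> is positive definite, the
  family \<open>(ortho_poly y a)\<close>, \<open>tdeg a \<le> d\<close>, is the only one that is triangular with respect to \<open><\<^sub>g\<^sub>l\<close>,
  orthonormal for \<^const>\<open>pinner\<close>\<open> y\<close>, and has positive inner products with the corresponding
  monomials: see \<open>keys_ortho_poly\<close>, \<open>ortho_poly_orthonormal\<close>, \<open>ortho_poly_xmon_pos\<close> and
  \<open>ortho_poly_unique\<close> below.
\<close>

function ortho_poly ::
    "(('n::{finite,linorder}, 'm::{finite,linorder}) expo \<Rightarrow> real) \<Rightarrow> ('n, 'm) expo \<Rightarrow> ('n, 'm) rpoly"
  where
  "ortho_poly y a =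
     (let q = xmon a - (\<Sum>b\<in>{b. b <\<^sub>g\<^sub>l a}. pscale (pinner y (xmon a) (ortho_poly y b)) (ortho_poly y b))
      in pscale (1 / sqrt (pinner y q q)) q)"
  by auto
termination
  by (relation "inv_image {(a, b). a <\<^sub>g\<^sub>l b} snd") (auto intro!: wf_inv_image wf_gl_less)

declare ortho_poly.simps [simp del]


definition rho ::
    "(('n::{finite,linorder}, 'm::{finite,linorder}) expo \<Rightarrow> real) \<Rightarrow> ('n, 'm) expo \<Rightarrow> ('n, 'm) expo \<Rightarrow> real"
  where "rho y a a' = Poly_Mapping.lookup (ortho_poly y a) a'"


subsection \<open>The two conditions\<close>

definition vmax :: "nat ^ 'k::finite \<Rightarrow> nat ^ 'k \<Rightarrow> nat ^ 'k" where
  "vmax \<beta> \<beta>' = (\<chi> i. max (\<beta> $ i) (\<beta>' $ i))"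

definition cond_triangular ::
    "(('n::{finite,linorder}, 'm::{finite,linorder}) expo \<Rightarrow> real) \<Rightarrow> nat \<Rightarrow> bool" where
  "cond_triangular y d \<longleftrightarrow>
     (\<forall>\<alpha> \<beta> \<alpha>' \<beta>'. tdeg (\<alpha>, \<beta>) \<le> d \<longrightarrow> (\<alpha>', \<beta>') \<le>\<^sub>g\<^sub>l (\<alpha>, \<beta>) \<longrightarrow> \<not> \<beta>' \<le> \<beta> \<longrightarrow>
        rho y (\<alpha>, \<beta>) (\<alpha>', \<beta>') = 0)"

definition zero_in_inverse ::
    "(('n::{finite,linorder}, 'm::{finite,linorder}) expo \<Rightarrow> real) \<Rightarrow> nat \<Rightarrow> bool" where
  "zero_in_inverse y r \<longleftrightarrow>
     (\<forall>\<alpha> \<beta> \<alpha>' \<beta>'. (\<alpha>', \<beta>') \<le>\<^sub>g\<^sub>l (\<alpha>, \<beta>) \<longrightarrow> tdeg (\<alpha>, \<beta>) \<le> r \<longrightarrow>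
        (\<forall>\<gamma> \<sigma>. (\<alpha>, \<beta>) \<le>\<^sub>g\<^sub>l (\<gamma>, \<sigma>) \<and> (\<alpha>', \<beta>') \<le>\<^sub>g\<^sub>l (\<gamma>, \<sigma>) \<and> vmax \<beta> \<beta>' \<le> \<sigma> \<longrightarrow>
           tdeg (\<gamma>, \<sigma>) > r) \<longrightarrow>
        inverse_on (expos_upto r) (moment_matrix y) (\<alpha>, \<beta>) (\<alpha>', \<beta>') = 0)"


subsection \<open>The inverse of a positive definite matrix exists\<close>

lemma pos_def_on_subset:
  assumes "pos_def_on J A" "I \<subseteq> J" "finite J"
  shows "pos_def_on I A"
  unfolding pos_def_on_def
proof (intro conjI allI impI)
  show "\<forall>i\<in>I. \<forall>j\<in>I. A i j = A j i"
  proof (intro ballI)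
    fix i j
    assume "i \<in> I" "j \<in> I"
    then have "i \<in> J" "j \<in> J" using assms(2) by auto
    moreover have "\<forall>i\<in>J. \<forall>j\<in>J. A i j = A j i"
      using assms(1) by (simp add: pos_def_on_def)
    ultimately show "A i j = A j i" by blast
  qed
next
  fix v :: "'a \<Rightarrow> real"
  assume v: "\<exists>i\<in>I. v i \<noteq> 0"
  define w where "w = (\<lambda>i. if i \<in> I then v i else 0)"
  have "\<exists>i\<in>J. w i \<noteq> 0"
    using v assms(2) by (auto simp: w_def)
  then have "0 < (\<Sum>i\<in>J. \<Sum>j\<in>J. w i * A i j * w j)"
    using assms(1) unfolding pos_def_on_def by blast
  also have "\<dots> = (\<Sum>i\<in>I. \<Sum>j\<in>J. w i * A i j * w j)"
    by (rule sum.mono_neutral_right) (use assms in \<open>auto simp: w_def\<close>)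
  also have "\<dots> = (\<Sum>i\<in>I. \<Sum>j\<in>I. w i * A i j * w j)"
    by (intro sum.cong refl sum.mono_neutral_right) (use assms in \<open>auto simp: w_def\<close>)
  also have "\<dots> = (\<Sum>i\<in>I. \<Sum>j\<in>I. v i * A i j * v j)"
    by (intro sum.cong refl) (auto simp: w_def)
  finally show "0 < (\<Sum>i\<in>I. \<Sum>j\<in>I. v i * A i j * v j)" .
qed

lemma pos_def_on_solvable:
  assumes "finite I" "pos_def_on I A"
  shows "\<exists>x. \<forall>i\<in>I. (\<Sum>k\<in>I. A i k * x k) = b i"
  using assms
proof (induction I arbitrary: b rule: finite_induct)
  case empty
  then show ?case by simp
next
  case (insert j I)
  have pdI: "pos_def_on I A"
    by (rule pos_def_on_subset[OF insert.prems]) (use insert in auto)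
  obtain c where c: "\<And>i. i \<in> I \<Longrightarrow> (\<Sum>k\<in>I. A i k * c k) = A i j"
    using insert.IH[OF pdI, of "\<lambda>i. A i j"] by blast
  obtain u where u: "\<And>i. i \<in> I \<Longrightarrow> (\<Sum>k\<in>I. A i k * u k) = b i"
    using insert.IH[OF pdI, of b] by blast
  define s where "s = A j j - (\<Sum>k\<in>I. A j k * c k)"
  define v where "v = (\<lambda>i. if i = j then 1 else - c i)"
  have vj: "v j = 1" and vI: "\<And>i. i \<in> I \<Longrightarrow> v i = - c i"
    using insert.hyps by (auto simp: v_def)
  have row: "(\<Sum>k\<in>insert j I. A i k * v k) = A i j - (\<Sum>k\<in>I. A i k * c k)" for i
    using insert.hyps by (simp add: vj vI sum_negf)
  have "(\<Sum>i\<in>insert j I. \<Sum>k\<in>insert j I. v i * A i k * v k)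
      = (\<Sum>i\<in>insert j I. v i * (\<Sum>k\<in>insert j I. A i k * v k))"
    unfolding sum_distrib_left by (simp add: mult.assoc)
  also have "\<dots> = s"
    unfolding row using insert.hyps by (simp add: vj c s_def)
  finally have s: "(\<Sum>i\<in>insert j I. \<Sum>k\<in>insert j I. v i * A i k * v k) = s" .
  have "\<exists>i\<in>insert j I. v i \<noteq> 0"
    by (rule bexI[of _ j]) (simp_all add: vj)
  then have "(\<Sum>i\<in>insert j I. \<Sum>k\<in>insert j I. v i * A i k * v k) > 0"
    using insert.prems unfolding pos_def_on_def by blast
  then have "s > 0" by (simp only: s)
  define t where "t = (b j - (\<Sum>k\<in>I. A j k * u k)) / s"
  define x where "x = (\<lambda>i. if i = j then t else u i - t * c i)"
  have xj: "x j = t" and xI: "\<And>i. i \<in> I \<Longrightarrow> x i = u i - t * c i"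
    using insert.hyps by (auto simp: x_def)
  have rowx: "(\<Sum>k\<in>insert j I. A i k * x k)
      = t * A i j + (\<Sum>k\<in>I. A i k * u k) - t * (\<Sum>k\<in>I. A i k * c k)" for i
    using insert.hyps
    by (simp add: xj xI algebra_simps sum_subtractf sum_distrib_left)
  have "(\<Sum>k\<in>insert j I. A i k * x k) = b i" if "i \<in> insert j I" for i
  proof (cases "i = j")
    case True
    have "(\<Sum>k\<in>insert j I. A i k * x k) = t * s + (\<Sum>k\<in>I. A j k * u k)"
      unfolding rowx by (simp add: True s_def algebra_simps)
    then show ?thesis using \<open>s > 0\<close> by (simp add: t_def True)
  next
    case False
    then show ?thesis using that unfolding rowx by (simp add: c u)
  qed
  then show ?case by blast
qed

lemma is_inverse_on_unique:
  assumes "finite I" "is_inverse_on I A Z" "is_inverse_on I A W"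
  shows "Z = W"
proof (intro ext)
  fix i j
  show "Z i j = W i j"
  proof (cases "i \<in> I \<and> j \<in> I")
    case False
    then show ?thesis using assms by (auto simp: is_inverse_on_def)
  next
    case True
    have "Z i j = (\<Sum>k\<in>I. Z i k * (if k = j then 1 else 0))"
      using True assms(1) by (simp add: if_distrib[of "\<lambda>t. _ * t"] cong: if_cong)
    also have "\<dots> = (\<Sum>k\<in>I. Z i k * (\<Sum>l\<in>I. A k l * W l j))"
      using True assms(3) by (intro sum.cong refl) (simp add: is_inverse_on_def)
    also have "\<dots> = (\<Sum>l\<in>I. (\<Sum>k\<in>I. Z i k * A k l) * W l j)"
      unfolding sum_distrib_left sum_distrib_right
      by (subst sum.swap) (simp add: mult.assoc)
    also have "\<dots> = (\<Sum>l\<in>I. (if i = l then 1 else 0) * W l j)"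
      using True assms(2) by (intro sum.cong refl) (simp add: is_inverse_on_def)
    also have "\<dots> = W i j"
      using True assms(1) by (simp add: if_distrib[of "\<lambda>t. t * _"] cong: if_cong)
    finally show ?thesis .
  qed
qed

lemma inverse_on_eqI:
  assumes "finite I" "is_inverse_on I A Z"
  shows "inverse_on I A = Z"
  unfolding inverse_on_def
  using assms is_inverse_on_unique by (metis the_equality)

lemma is_inverse_on_inverse_on:
  assumes "finite I" "pos_def_on I A"
  shows "is_inverse_on I A (inverse_on I A)"
proof -
  have sym: "A i j = A j i" if "i \<in> I" "j \<in> I" for i j
    using assms(2) that by (auto simp: pos_def_on_def)
  have "\<exists>x. \<forall>i\<in>I. (\<Sum>k\<in>I. A i k * x k) = (if i = j then 1 else 0)" for j
    by (rule pos_def_on_solvable[OF assms])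
  then obtain x where x: "\<And>j i. i \<in> I \<Longrightarrow> (\<Sum>k\<in>I. A i k * x j k) = (if i = j then 1 else 0)"
    by metis
  have xsym: "x i j = x j i" if ij: "i \<in> I" "j \<in> I" for i j
  proof -
    have "x i j = (\<Sum>k\<in>I. x i k * (if k = j then 1 else 0))"
      using ij assms(1) by (simp add: if_distrib[of "\<lambda>t. _ * t"] cong: if_cong)
    also have "\<dots> = (\<Sum>k\<in>I. x i k * (\<Sum>l\<in>I. A k l * x j l))"
      by (intro sum.cong refl) (simp add: x)
    also have "\<dots> = (\<Sum>l\<in>I. (\<Sum>k\<in>I. A k l * x i k) * x j l)"
      unfolding sum_distrib_left sum_distrib_right
      by (subst sum.swap) (simp add: mult_ac)
    also have "\<dots> = (\<Sum>l\<in>I. (\<Sum>k\<in>I. A l k * x i k) * x j l)"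
      by (intro sum.cong refl arg_cong2[where f = "(*)"]) (auto simp: sym)
    also have "\<dots> = (\<Sum>l\<in>I. (if l = i then 1 else 0) * x j l)"
      by (intro sum.cong refl) (simp add: x)
    also have "\<dots> = x j i"
      using ij assms(1) by (simp add: if_distrib[of "\<lambda>t. t * _"] cong: if_cong)
    finally show ?thesis .
  qed
  define Z where "Z = (\<lambda>i j. if i \<in> I \<and> j \<in> I then x j i else 0)"
  have right: "(\<Sum>k\<in>I. A i k * Z k j) = (if i = j then 1 else 0)" if "i \<in> I" "j \<in> I" for i j
  proof -
    have "(\<Sum>k\<in>I. A i k * Z k j) = (\<Sum>k\<in>I. A i k * x j k)"
      by (intro sum.cong refl) (simp add: Z_def that)
    then show ?thesis using x that by simp
  qed
  have left: "(\<Sum>k\<in>I. Z i k * A k j) = (if i = j then 1 else 0)" if "i \<in> I" "j \<in> I" for i j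
  proof -
    have "(\<Sum>k\<in>I. Z i k * A k j) = (\<Sum>k\<in>I. A j k * Z k i)"
      by (intro sum.cong refl) (auto simp: Z_def that xsym sym)
    then show ?thesis using right that by simp
  qed
  have "is_inverse_on I A Z"
    unfolding is_inverse_on_def using left right by (auto simp: Z_def)
  then show ?thesis
    using inverse_on_eqI[OF assms(1)] by simp
qed


subsection \<open>Defining properties of the orthonormal polynomials\<close>

lemma rpoly_expand:
  assumes "finite S" "Poly_Mapping.keys p \<subseteq> S"
  shows "p = (\<Sum>a\<in>S. Poly_Mapping.single a (Poly_Mapping.lookup p a))"
  using assms
  by (intro poly_mapping_eqI)
     (auto simp: lookup_sum lookup_single when_def in_keys_iff)

lemma riesz_superset:
  assumes "finite S" "Poly_Mapping.keys p \<subseteq> S"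
  shows "riesz y p = (\<Sum>a\<in>S. Poly_Mapping.lookup p a * y a)"
  unfolding riesz_def
  by (rule sum.mono_neutral_left) (use assms in \<open>auto simp: in_keys_iff\<close>)

lemma riesz_add: "riesz y (p + q) = riesz y p + riesz y q"
proof -
  let ?S = "Poly_Mapping.keys p \<union> Poly_Mapping.keys q"
  have "riesz y (p + q) = (\<Sum>a\<in>?S. Poly_Mapping.lookup (p + q) a * y a)"
    by (rule riesz_superset) (simp_all add: Poly_Mapping.keys_add)
  also have "\<dots> = riesz y p + riesz y q"
    by (simp add: riesz_superset[of ?S] lookup_add algebra_simps sum.distrib)
  finally show ?thesis .
qed

lemma riesz_zero [simp]: "riesz y 0 = 0"
  by (simp add: riesz_def)

lemma riesz_single [simp]: "riesz y (Poly_Mapping.single a c) = c * y a"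
  by (simp add: riesz_def)

lemma lookup_pscale [simp]: "Poly_Mapping.lookup (pscale c p) a = c * Poly_Mapping.lookup p a"
  by (simp add: mult_map_scale_conv_mult[symmetric] Poly_Mapping.map.rep_eq when_def)

lemma riesz_pscale: "riesz y (pscale c p) = c * riesz y p"
proof -
  have "Poly_Mapping.keys (pscale c p) \<subseteq> Poly_Mapping.keys p"
    by (auto simp: in_keys_iff)
  then show ?thesis
    by (simp add: riesz_superset[of "Poly_Mapping.keys p"] sum_distrib_left mult.assoc)
qed

lemma pinner_commute: "pinner y f g = pinner y g f"
  by (simp add: pinner_def mult.commute)

lemma pinner_add_left: "pinner y (f + g) h = pinner y f h + pinner y g h"
  by (simp add: pinner_def distrib_right riesz_add)

lemma pinner_zero_left [simp]: "pinner y 0 h = 0"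
  by (simp add: pinner_def)

lemma pinner_diff_left: "pinner y (f - g) h = pinner y f h - pinner y g h"
  using pinner_add_left[of y "f - g" g h] by simp

lemma pinner_pscale_left: "pinner y (pscale c f) h = c * pinner y f h"
  by (simp add: pinner_def mult.assoc riesz_pscale)

lemma pinner_sum_left: "pinner y (\<Sum>i\<in>S. f i) h = (\<Sum>i\<in>S. pinner y (f i) h)"
  by (induction S rule: infinite_finite_induct) (auto simp: pinner_add_left)

lemma pinner_sum_right: "pinner y h (\<Sum>i\<in>S. f i) = (\<Sum>i\<in>S. pinner y h (f i))"
  by (simp add: pinner_commute[of y h] pinner_sum_left)

lemma pinner_pscale_right: "pinner y h (pscale c f) = c * pinner y h f"
  by (simp add: pinner_commute[of y h] pinner_pscale_left)

lemma pinner_diff_right: "pinner y h (f - g) = pinner y h f - pinner y h g"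
  by (simp add: pinner_commute[of y h] pinner_diff_left)

lemma pinner_expand:
  assumes "finite S" "Poly_Mapping.keys f \<subseteq> S" "Poly_Mapping.keys g \<subseteq> S"
  shows "pinner y f g = (\<Sum>a\<in>S. \<Sum>b\<in>S.
    Poly_Mapping.lookup f a * moment_matrix y a b * Poly_Mapping.lookup g b)"
proof -
  have single: "pinner y (Poly_Mapping.single a s) (Poly_Mapping.single b t) = s * moment_matrix y a b * t"
    for a b s t
    by (simp add: pinner_def mult_single moment_matrix_def mult_ac)
  have "pinner y f g = pinner y
      (\<Sum>a\<in>S. Poly_Mapping.single a (Poly_Mapping.lookup f a))
      (\<Sum>b\<in>S. Poly_Mapping.single b (Poly_Mapping.lookup g b))"
    using rpoly_expand[OF assms(1,2)] rpoly_expand[OF assms(1,3)] by simp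
  also have "\<dots> = (\<Sum>a\<in>S. \<Sum>b\<in>S.
      Poly_Mapping.lookup f a * moment_matrix y a b * Poly_Mapping.lookup g b)"
    unfolding pinner_sum_left pinner_sum_right single by (rule sum.swap)
  finally show ?thesis .
qed

lemma pinner_pos:
  assumes pd: "pos_def_on (expos_upto d) (moment_matrix y)"
    and f: "Poly_Mapping.keys f \<subseteq> expos_upto d" "f \<noteq> 0"
  shows "pinner y f f > 0"
proof -
  have "\<exists>i\<in>expos_upto d. Poly_Mapping.lookup f i \<noteq> 0"
  proof (rule ccontr)
    assume "\<not> ?thesis"
    then have "Poly_Mapping.lookup f i = 0" for i
      using f(1) by (cases "i \<in> expos_upto d") (auto simp: in_keys_iff)
    then have "f = 0" by (intro poly_mapping_eqI) simp
    then show False using f(2) by simp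
  qed
  then have "0 < (\<Sum>a\<in>expos_upto d. \<Sum>b\<in>expos_upto d.
      Poly_Mapping.lookup f a * moment_matrix y a b * Poly_Mapping.lookup f b)"
    using pd unfolding pos_def_on_def by blast
  then show ?thesis
    by (simp only: pinner_expand[OF finite_expos_upto f(1) f(1)])
qed

definition gs_rem ::
    "(('n::{finite,linorder}, 'm::{finite,linorder}) expo \<Rightarrow> real) \<Rightarrow> ('n, 'm) expo \<Rightarrow> ('n, 'm) rpoly"
  where
  "gs_rem y a = xmon a -
     (\<Sum>b\<in>{b. b <\<^sub>g\<^sub>l a}. pscale (pinner y (xmon a) (ortho_poly y b)) (ortho_poly y b))"

lemma ortho_poly_gs_rem:
  "ortho_poly y a = pscale (1 / sqrt (pinner y (gs_rem y a) (gs_rem y a))) (gs_rem y a)"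
  by (subst ortho_poly.simps) (simp add: Let_def gs_rem_def)

lemma keys_pscale: "Poly_Mapping.keys (pscale c p) \<subseteq> Poly_Mapping.keys p"
  by (auto simp: in_keys_iff)

lemma keys_gs_rem_aux:
  assumes "\<And>b. b <\<^sub>g\<^sub>l a \<Longrightarrow> Poly_Mapping.keys (ortho_poly y b) \<subseteq> {c. c \<le>\<^sub>g\<^sub>l b}"
  shows "Poly_Mapping.keys (gs_rem y a) \<subseteq> {b. b \<le>\<^sub>g\<^sub>l a}"
proof
  fix c
  assume "c \<in> Poly_Mapping.keys (gs_rem y a)"
  then have nz: "Poly_Mapping.lookup (gs_rem y a) c \<noteq> 0"
    by (simp add: in_keys_iff)
  show "c \<in> {b. b \<le>\<^sub>g\<^sub>l a}"
  proof (rule ccontr)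
    assume c: "c \<notin> {b. b \<le>\<^sub>g\<^sub>l a}"
    have "Poly_Mapping.lookup (ortho_poly y b) c = 0" if "b <\<^sub>g\<^sub>l a" for b
    proof -
      have "\<not> c \<le>\<^sub>g\<^sub>l b"
        using c that gl_less_trans unfolding gl_le_def by blast
      then show ?thesis using assms[OF that] by (auto simp: in_keys_iff)
    qed
    then have "Poly_Mapping.lookup (gs_rem y a) c = 0"
      using c by (auto simp: gs_rem_def lookup_minus lookup_sum lookup_single gl_le_def when_def)
    then show False using nz by simp
  qed
qed

lemma keys_ortho_poly: "Poly_Mapping.keys (ortho_poly y a) \<subseteq> {b. b \<le>\<^sub>g\<^sub>l a}"
proof (induction a rule: wf_induct_rule[OF wf_gl_less])
  case (1 a)
  have "Poly_Mapping.keys (gs_rem y a) \<subseteq> {b. b \<le>\<^sub>g\<^sub>l a}"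
    by (rule keys_gs_rem_aux) (use 1 in simp)
  then show ?case
    unfolding ortho_poly_gs_rem using keys_pscale by blast
qed

lemma keys_gs_rem: "Poly_Mapping.keys (gs_rem y a) \<subseteq> {b. b \<le>\<^sub>g\<^sub>l a}"
  by (rule keys_gs_rem_aux) (rule keys_ortho_poly)

lemma lookup_gs_rem_self: "Poly_Mapping.lookup (gs_rem y a) a = 1"
proof -
  have "Poly_Mapping.lookup (ortho_poly y b) a = 0" if "b <\<^sub>g\<^sub>l a" for b
  proof -
    have "\<not> a \<le>\<^sub>g\<^sub>l b"
      using that gl_less_trans gl_less_irrefl unfolding gl_le_def by blast
    then show ?thesis using keys_ortho_poly[of y b] by (auto simp: in_keys_iff)
  qed
  then show ?thesis
    by (simp add: gs_rem_def lookup_minus lookup_sum)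
qed

context
  fixes y :: "('n::{finite,linorder}, 'm::{finite,linorder}) expo \<Rightarrow> real" and d :: nat
  assumes pd: "pos_def_on (expos_upto d) (moment_matrix y)"
begin

lemma gs_rem_norm_pos:
  assumes "tdeg a \<le> d"
  shows "pinner y (gs_rem y a) (gs_rem y a) > 0"
proof (rule pinner_pos[OF pd])
  show "Poly_Mapping.keys (gs_rem y a) \<subseteq> expos_upto d"
    by (rule subset_trans[OF keys_gs_rem gl_le_upto[OF assms]])
  show "gs_rem y a \<noteq> 0"
    using lookup_gs_rem_self[of y a] by auto
qed

lemma ortho_poly_norm:
  assumes "tdeg a \<le> d"
  shows "pinner y (ortho_poly y a) (ortho_poly y a) = 1"
  using gs_rem_norm_pos[OF assms]
  by (simp add: ortho_poly_gs_rem[of y a] pinner_pscale_left pinner_pscale_right)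

lemma ortho_poly_orth_less:
  assumes "tdeg a \<le> d" "b <\<^sub>g\<^sub>l a"
  shows "pinner y (ortho_poly y a) (ortho_poly y b) = 0"
  using assms
proof (induction a arbitrary: b rule: wf_induct_rule[OF wf_gl_less])
  case (1 a)
  have deg: "tdeg c \<le> d" if "c <\<^sub>g\<^sub>l a" for c
    using gl_less_tdeg[OF that] 1(2) by simp
  have orth: "pinner y (ortho_poly y c) (ortho_poly y b) = (if c = b then 1 else 0)"
    if c: "c <\<^sub>g\<^sub>l a" for c
  proof (cases "c = b")
    case True
    then show ?thesis using ortho_poly_norm[OF deg[OF c]] by simp
  next
    case False
    then have "b <\<^sub>g\<^sub>l c \<or> c <\<^sub>g\<^sub>l b" using gl_less_total by blast
    then have "pinner y (ortho_poly y c) (ortho_poly y b) = 0"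
    proof
      assume "b <\<^sub>g\<^sub>l c"
      then show ?thesis using 1(1)[of c b] c deg by auto
    next
      assume "c <\<^sub>g\<^sub>l b"
      then show ?thesis
        using 1(1)[of b c] 1(3) deg by (subst pinner_commute) auto
    qed
    then show ?thesis using False by simp
  qed
  have "pinner y (gs_rem y a) (ortho_poly y b) = pinner y (xmon a) (ortho_poly y b) -
      (\<Sum>c\<in>{c. c <\<^sub>g\<^sub>l a}. pinner y (xmon a) (ortho_poly y c) *
         pinner y (ortho_poly y c) (ortho_poly y b))"
    by (simp add: gs_rem_def pinner_diff_left pinner_sum_left pinner_pscale_left)
  also have "(\<Sum>c\<in>{c. c <\<^sub>g\<^sub>l a}. pinner y (xmon a) (ortho_poly y c) *
         pinner y (ortho_poly y c) (ortho_poly y b)) =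
      (\<Sum>c\<in>{c. c <\<^sub>g\<^sub>l a}. pinner y (xmon a) (ortho_poly y c) * (if c = b then 1 else 0))"
    by (intro sum.cong refl) (simp add: orth)
  also have "\<dots> = pinner y (xmon a) (ortho_poly y b)"
    using 1(3) finite_gl_below[of a] by (simp add: if_distrib[of "\<lambda>t. _ * t"] cong: if_cong)
  finally show ?case
    by (simp add: ortho_poly_gs_rem[of y a] pinner_pscale_left)
qed

lemma ortho_poly_orthonormal:
  assumes "tdeg a \<le> d" "tdeg b \<le> d"
  shows "pinner y (ortho_poly y a) (ortho_poly y b) = (if a = b then 1 else 0)"
proof (cases "a = b")
  case True
  then show ?thesis using ortho_poly_norm[OF assms(1)] by simp
next
  case False
  then have "b <\<^sub>g\<^sub>l a \<or> a <\<^sub>g\<^sub>l b" using gl_less_total by blast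
  then have "pinner y (ortho_poly y a) (ortho_poly y b) = 0"
  proof
    assume "b <\<^sub>g\<^sub>l a"
    then show ?thesis by (rule ortho_poly_orth_less[OF assms(1)])
  next
    assume "a <\<^sub>g\<^sub>l b"
    then show ?thesis
      by (subst pinner_commute) (rule ortho_poly_orth_less[OF assms(2)])
  qed
  then show ?thesis using False by simp
qed

lemma xmon_gs:
  assumes "tdeg a \<le> d"
  shows "xmon a = pscale (sqrt (pinner y (gs_rem y a) (gs_rem y a))) (ortho_poly y a) +
     (\<Sum>b\<in>{b. b <\<^sub>g\<^sub>l a}. pscale (pinner y (xmon a) (ortho_poly y b)) (ortho_poly y b))"
proof -
  have "pscale (sqrt (pinner y (gs_rem y a) (gs_rem y a))) (ortho_poly y a) = gs_rem y a"
    using gs_rem_norm_pos[OF assms]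
    by (intro poly_mapping_eqI) (simp add: ortho_poly_gs_rem[of y a])
  then show ?thesis by (simp add: gs_rem_def)
qed

lemma ortho_poly_xmon_pos:
  assumes "tdeg a \<le> d"
  shows "pinner y (ortho_poly y a) (xmon a) > 0"
proof -
  have "pinner y (xmon a) (ortho_poly y a) = sqrt (pinner y (gs_rem y a) (gs_rem y a))"
  proof -
    have "pinner y (ortho_poly y b) (ortho_poly y a) = 0" if "b <\<^sub>g\<^sub>l a" for b
      by (subst pinner_commute) (rule ortho_poly_orth_less[OF assms that])
    then show ?thesis
      using ortho_poly_norm[OF assms]
      by (subst xmon_gs[OF assms])
         (simp add: pinner_add_left pinner_pscale_left pinner_sum_left)
  qed
  then show ?thesis
    using gs_rem_norm_pos[OF assms] pinner_commute[of y "xmon a"] by simp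
qed

lemma ortho_poly_unique:
  assumes keys: "\<And>a. tdeg a \<le> d \<Longrightarrow> Poly_Mapping.keys (p a) \<subseteq> {b. b \<le>\<^sub>g\<^sub>l a}"
    and on: "\<And>a b. tdeg a \<le> d \<Longrightarrow> tdeg b \<le> d \<Longrightarrow> pinner y (p a) (p b) = (if a = b then 1 else 0)"
    and pos: "\<And>a. tdeg a \<le> d \<Longrightarrow> pinner y (p a) (xmon a) > 0"
    and "tdeg a \<le> d"
  shows "p a = ortho_poly y a"
  using \<open>tdeg a \<le> d\<close>
proof (induction a rule: wf_induct_rule[OF wf_gl_less])
  case (1 a)
  note a = 1(2)
  have deg: "tdeg c \<le> d" if "c <\<^sub>g\<^sub>l a" for c
    using gl_less_tdeg[OF that] a by simp
  have orth: "pinner y (p a) (xmon b) = 0" "pinner y (ortho_poly y a) (xmon b) = 0"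
    if b: "b <\<^sub>g\<^sub>l a" for b
  proof -
    have 2: "pinner y (p a) (ortho_poly y c) = 0" "pinner y (ortho_poly y a) (ortho_poly y c) = 0"
      if c: "c <\<^sub>g\<^sub>l a" for c
    proof -
      have "a \<noteq> c" using c gl_less_irrefl by blast
      then have "pinner y (p a) (p c) = 0" by (simp add: on[OF a deg[OF c]])
      moreover have "p c = ortho_poly y c" using 1(1) c deg[OF c] by blast
      ultimately show "pinner y (p a) (ortho_poly y c) = 0" by simp
      show "pinner y (ortho_poly y a) (ortho_poly y c) = 0"
        by (rule ortho_poly_orth_less[OF a c])
    qed
    have 3: "c <\<^sub>g\<^sub>l a" if "c <\<^sub>g\<^sub>l b" for c
      using gl_less_trans that b by blast
    have G: "pinner y (xmon b) h = 0" if h: "\<And>c. c <\<^sub>g\<^sub>l a \<Longrightarrow> pinner y (ortho_poly y c) h = 0" for h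
      by (subst xmon_gs[OF deg[OF b]])
         (simp add: pinner_add_left pinner_pscale_left pinner_sum_left h b 3)
    show "pinner y (p a) (xmon b) = 0"
      by (subst pinner_commute, rule G, subst pinner_commute, rule 2)
    show "pinner y (ortho_poly y a) (xmon b) = 0"
      by (subst pinner_commute, rule G, subst pinner_commute, rule 2)
  qed
  define s where "s = pinner y (p a) (xmon a)"
  define t where "t = pinner y (ortho_poly y a) (xmon a)"
  have st: "s > 0" "t > 0"
    using pos[OF a] ortho_poly_xmon_pos[OF a] by (auto simp: s_def t_def)
  define e where "e = pscale t (p a) - pscale s (ortho_poly y a)"
  have e_orth: "pinner y e (xmon b) = 0" if "b \<le>\<^sub>g\<^sub>l a" for b
  proof (cases "b = a")
    case True
    then show ?thesis
      by (simp add: e_def pinner_diff_left pinner_pscale_left s_def t_def)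
  next
    case False
    then have "b <\<^sub>g\<^sub>l a" using that by (simp add: gl_le_def)
    then show ?thesis
      by (simp add: e_def pinner_diff_left pinner_pscale_left orth)
  qed
  have e_keys: "Poly_Mapping.keys e \<subseteq> {b. b \<le>\<^sub>g\<^sub>l a}"
  proof
    fix c
    assume "c \<in> Poly_Mapping.keys e"
    then have "Poly_Mapping.lookup e c \<noteq> 0" by (simp add: in_keys_iff)
    then have "Poly_Mapping.lookup (p a) c \<noteq> 0 \<or> Poly_Mapping.lookup (ortho_poly y a) c \<noteq> 0"
      by (auto simp: e_def lookup_minus)
    then have "c \<in> Poly_Mapping.keys (p a) \<or> c \<in> Poly_Mapping.keys (ortho_poly y a)"
      by (simp add: in_keys_iff)
    then show "c \<in> {b. b \<le>\<^sub>g\<^sub>l a}"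
      using keys[OF a] keys_ortho_poly[of y a] by blast
  qed
  have "e = 0"
  proof (rule ccontr)
    assume "e \<noteq> 0"
    have "Poly_Mapping.keys e \<subseteq> expos_upto d"
      by (rule subset_trans[OF e_keys gl_le_upto[OF a]])
    then have "pinner y e e > 0" by (rule pinner_pos[OF pd _ \<open>e \<noteq> 0\<close>])
    moreover have "pinner y e e =
        pinner y e (\<Sum>b\<in>Poly_Mapping.keys e. pscale (Poly_Mapping.lookup e b) (xmon b))"
      using rpoly_expand[of "Poly_Mapping.keys e" e] by (simp add: mult_single)
    moreover have "\<dots> = 0"
      unfolding pinner_sum_right pinner_pscale_right
      using e_orth e_keys by (intro sum.neutral) auto
    ultimately show False by simp
  qed
  then have eq: "pscale t (p a) = pscale s (ortho_poly y a)"
    by (simp add: e_def)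
  have "pinner y (pscale t (p a)) (pscale t (p a)) = t * t"
    using on[OF a a] by (simp add: pinner_pscale_left pinner_pscale_right)
  moreover have "pinner y (pscale s (ortho_poly y a)) (pscale s (ortho_poly y a)) = s * s"
    using ortho_poly_norm[OF a] by (simp add: pinner_pscale_left pinner_pscale_right)
  ultimately have "s = t"
    using eq st by (simp add: power2_eq_square[symmetric])
  then have "t * Poly_Mapping.lookup (p a) c = t * Poly_Mapping.lookup (ortho_poly y a) c" for c
    using arg_cong[OF eq, of "\<lambda>p. Poly_Mapping.lookup p c"] by (simp add: \<open>s = t\<close>)
  then show ?case
    using st by (intro poly_mapping_eqI) simp
qed

end

end

theory Submission
  imports Defs
begin

text \<open>
  If \<open>R\<close> is the lower triangular matrix of the coefficients \<open>\<rho>\<close> of the orthonormal polynomials of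
  degree at most \<open>r\<close>, then \<open>M\<^sub>r(y)\<^sup>-\<^sup>1 = R\<^sup>T R\<close>.  Under \<open>(O)\<^sub>d\<close> each product in the resulting sum for a
  critical entry vanishes.  Conversely, an index \<open>(\<gamma>, \<sigma>)\<close> of the same degree as \<open>(\<alpha>, \<beta>)\<close> lying above it
  satisfies \<open>|\<sigma>| \<le> |\<beta>|\<close>, so \<open>\<sigma> \<ge> max(\<beta>, \<beta>')\<close> would force \<open>\<sigma> = \<beta> \<ge> \<beta>'\<close>; hence, descending along the
  order within degree \<open>r\<close>, the entry of \<open>M\<^sub>r(y)\<^sup>-\<^sup>1\<close> at \<open>(\<alpha>, \<beta>), (\<alpha>', \<beta>')\<close> vanishes by \<open>(V)\<^sub>r\<close> and reduces
  to the diagonal coefficient \<open>\<rho>\<close> at \<open>(\<alpha>, \<beta>)\<close>, which is nonzero, times the coefficient in question.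
\<close>

lemma vdeg_le_imp_eq:
  fixes \<beta> \<sigma> :: "nat ^ 'k::finite"
  assumes "\<beta> \<le> \<sigma>" "vdeg \<sigma> \<le> vdeg \<beta>"
  shows "\<sigma> = \<beta>"
proof -
  have le: "\<beta> $ i \<le> \<sigma> $ i" for i
    using assms(1) by (simp add: less_eq_vec_def)
  have "(\<Sum>i\<in>UNIV. \<beta> $ i) = (\<Sum>i\<in>UNIV. \<sigma> $ i)"
    using assms(2) by (intro antisym[OF sum_mono[OF le]]) (simp add: vdeg_def)
  then have "\<beta> $ i = \<sigma> $ i" for i
    by (rule sum_mono_inv) (use le in auto)
  then show ?thesis by (simp add: vec_eq_iff)
qed

text \<open>The hypotheses force equal total degrees. Ties are then broken on the
  \<open>X\<close>-part first, so going up cannot lower its degree and cannot raise that of the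
  \<open>Y\<close>-part.\<close>

lemma gl_le_vdeg_snd:
  assumes "a \<le>\<^sub>g\<^sub>l c" "tdeg c \<le> tdeg a"
  shows "vdeg (snd c) \<le> vdeg (snd a)"
  using assms by (auto simp: gl_le_def gl_less_def gl_less_vec_def tdeg_def)

lemma vmax_le_iff: "vmax \<beta> \<beta>' \<le> \<sigma> \<longleftrightarrow> \<beta> \<le> \<sigma> \<and> \<beta>' \<le> \<sigma>"
  by (auto simp: vmax_def less_eq_vec_def)

lemma rho_eq_0: "\<not> b \<le>\<^sub>g\<^sub>l a \<Longrightarrow> rho y a b = 0"
  using keys_ortho_poly[of y a] by (auto simp: rho_def in_keys_iff)

context
  fixes y :: "('n::{finite,linorder}, 'm::{finite,linorder}) expo \<Rightarrow> real" and r :: nat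
  assumes pd: "pos_def_on (expos_upto r) (moment_matrix y)"
begin

lemma rho_diag_neq_0:
  assumes "tdeg a \<le> r"
  shows "rho y a a \<noteq> 0"
  using gs_rem_norm_pos[OF pd assms]
  by (simp add: rho_def ortho_poly_gs_rem[of y a] lookup_gs_rem_self)

text \<open>Comparing coefficients in this Fourier expansion gives M R^T R = I, with R the matrix of
  \<open>rho\<close>.\<close>

lemma xmon_fourier:
  assumes b: "tdeg b \<le> r"
  shows "xmon b =
    (\<Sum>c\<in>expos_upto r. pscale (pinner y (xmon b) (ortho_poly y c)) (ortho_poly y c))"
proof -
  \<comment> \<open>The coefficients that Gram-Schmidt produces, padded with zeros; orthonormality
    then identifies them as inner products.\<close>
  define k where "k c = (if c = b then sqrt (pinner y (gs_rem y b) (gs_rem y b))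
    else if c <\<^sub>g\<^sub>l b then pinner y (xmon b) (ortho_poly y c) else 0)" for c
  have ins: "insert b {c. c <\<^sub>g\<^sub>l b} \<subseteq> expos_upto r"
    using gl_le_upto[OF b] by (auto simp: gl_le_def)
  have "xmon b = (\<Sum>c\<in>insert b {c. c <\<^sub>g\<^sub>l b}. pscale (k c) (ortho_poly y c))"
    by (subst xmon_gs[OF pd b], subst sum.insert)
       (auto simp: finite_gl_below gl_less_irrefl k_def intro!: sum.cong)
  also have "\<dots> = (\<Sum>c\<in>expos_upto r. pscale (k c) (ortho_poly y c))"
    by (rule sum.mono_neutral_left[OF finite_expos_upto ins]) (auto simp: k_def)
  finally have eq: "xmon b = (\<Sum>c\<in>expos_upto r. pscale (k c) (ortho_poly y c))" .
  have "pinner y (xmon b) (ortho_poly y c) = k c" if c: "c \<in> expos_upto r" for c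
  proof -
    have "pinner y (xmon b) (ortho_poly y c) =
        (\<Sum>e\<in>expos_upto r. k e * pinner y (ortho_poly y e) (ortho_poly y c))"
      by (subst eq) (simp add: pinner_sum_left pinner_pscale_left)
    also have "\<dots> = (\<Sum>e\<in>expos_upto r. if e = c then k e else 0)"
      using c ortho_poly_orthonormal[OF pd, of _ c]
      by (intro sum.cong refl) (simp add: expos_upto_def)
    finally show ?thesis using c by (simp add: finite_expos_upto)
  qed
  then show ?thesis using eq by simp
qed

text \<open>The Fourier coefficients are the entries of M R^T.\<close>

lemma pinner_xmon_ortho_poly:
  assumes "b \<in> expos_upto r" "c \<in> expos_upto r"
  shows "pinner y (xmon b) (ortho_poly y c) = (\<Sum>k\<in>expos_upto r. moment_matrix y b k * rho y c k)"
proof -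
  have keys: "Poly_Mapping.keys (ortho_poly y c) \<subseteq> expos_upto r"
    using assms(2) by (intro subset_trans[OF keys_ortho_poly gl_le_upto]) (simp add: expos_upto_def)
  have "pinner y (xmon b) (ortho_poly y c) =
      (\<Sum>a\<in>expos_upto r. \<Sum>k\<in>expos_upto r.
        Poly_Mapping.lookup (xmon b) a * moment_matrix y a k * rho y c k)"
    unfolding rho_def by (rule pinner_expand[OF finite_expos_upto _ keys]) (use assms in simp)
  also have "\<dots> = (\<Sum>a\<in>expos_upto r. if a = b then
        (\<Sum>k\<in>expos_upto r. moment_matrix y b k * rho y c k) else 0)"
    by (intro sum.cong refl) (simp add: lookup_single when_def)
  finally show ?thesis using assms(1) by (simp add: finite_expos_upto)
qed

lemma inverse_moment_matrix:
  assumes ab: "a \<in> expos_upto r" "b \<in> expos_upto r"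
  shows "inverse_on (expos_upto r) (moment_matrix y) a b =
    (\<Sum>c\<in>expos_upto r. rho y c a * rho y c b)"
proof -
  let ?I = "expos_upto r :: ('n, 'm) expo set"
  define Z where "Z i j = (if i \<in> ?I \<and> j \<in> ?I then \<Sum>c\<in>?I. rho y c i * rho y c j else 0)" for i j
  have right: "(\<Sum>k\<in>?I. moment_matrix y i k * Z k j) = (if i = j then 1 else 0)"
    if ij: "i \<in> ?I" "j \<in> ?I" for i j
  proof -
    have "(\<Sum>k\<in>?I. moment_matrix y i k * Z k j) =
        (\<Sum>k\<in>?I. \<Sum>c\<in>?I. moment_matrix y i k * rho y c k * rho y c j)"
      using ij by (intro sum.cong refl) (simp add: Z_def sum_distrib_left mult.assoc)
    also have "\<dots> = (\<Sum>c\<in>?I. (\<Sum>k\<in>?I. moment_matrix y i k * rho y c k) * rho y c j)"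
      by (subst sum.swap) (simp add: sum_distrib_right)
    also have "\<dots> = (\<Sum>c\<in>?I. pinner y (xmon i) (ortho_poly y c) * rho y c j)"
      using ij by (intro sum.cong refl) (simp add: pinner_xmon_ortho_poly)
    also have "\<dots> = Poly_Mapping.lookup
        (\<Sum>c\<in>?I. pscale (pinner y (xmon i) (ortho_poly y c)) (ortho_poly y c)) j"
      by (simp add: lookup_sum rho_def)
    also have "\<dots> = Poly_Mapping.lookup (xmon i) j"
      using ij by (subst xmon_fourier[symmetric]) (auto simp: expos_upto_def)
    finally show ?thesis by (simp add: lookup_single when_def)
  qed
  \<comment> \<open>Both matrices are symmetric, so the right inverse is also a left
    inverse.\<close>
  have comm: "Z i k * moment_matrix y k j = moment_matrix y j k * Z k i" for i j k
    by (simp add: Z_def moment_matrix_def add.commute mult.commute)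
  have "is_inverse_on ?I (moment_matrix y) Z"
    unfolding is_inverse_on_def comm using right by (auto simp: Z_def)
  then have "inverse_on ?I (moment_matrix y) = Z"
    by (rule inverse_on_eqI[OF finite_expos_upto])
  then show ?thesis using ab by (simp add: Z_def)
qed

end

lemma cond_triangular_imp_zero_in_inverse:
  fixes y :: "('n::{finite,linorder}, 'm::{finite,linorder}) expo \<Rightarrow> real"
  assumes pd: "pos_def_on (expos_upto r) (moment_matrix y)"
    and tri: "cond_triangular y r"
  shows "zero_in_inverse y r"
  unfolding zero_in_inverse_def
proof (intro allI impI)
  fix \<alpha> \<alpha>' :: "(nat, 'n) vec" and \<beta> \<beta>' :: "(nat, 'm) vec"
  assume le: "(\<alpha>', \<beta>') \<le>\<^sub>g\<^sub>l (\<alpha>, \<beta>)" and deg: "tdeg (\<alpha>, \<beta>) \<le> r"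
    and H: "\<forall>\<gamma> \<sigma>. (\<alpha>, \<beta>) \<le>\<^sub>g\<^sub>l (\<gamma>, \<sigma>) \<and> (\<alpha>', \<beta>') \<le>\<^sub>g\<^sub>l (\<gamma>, \<sigma>) \<and> vmax \<beta> \<beta>' \<le> \<sigma> \<longrightarrow>
      r < tdeg (\<gamma>, \<sigma>)"
  have "rho y c (\<alpha>, \<beta>) * rho y c (\<alpha>', \<beta>') = 0" if c: "c \<in> expos_upto r" for c
  proof (rule ccontr)
    assume nz: "\<not> ?thesis"
    obtain \<gamma> \<sigma> where [simp]: "c = (\<gamma>, \<sigma>)" by (cases c)
    have deg_c: "tdeg (\<gamma>, \<sigma>) \<le> r" using c by (simp add: expos_upto_def)
    have ge: "(\<alpha>, \<beta>) \<le>\<^sub>g\<^sub>l (\<gamma>, \<sigma>)" "(\<alpha>', \<beta>') \<le>\<^sub>g\<^sub>l (\<gamma>, \<sigma>)"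
      using nz rho_eq_0[of _ c y] by auto
    \<comment> \<open>A nonzero product makes \<open>c\<close> a common upper bound of degree at
      most \<open>r\<close>, which \<open>H\<close> rules out.\<close>
    have "\<beta> \<le> \<sigma>" "\<beta>' \<le> \<sigma>"
      using nz tri ge deg_c unfolding cond_triangular_def by auto
    then show False using H ge deg_c by (auto simp: vmax_le_iff not_less[symmetric])
  qed
  then show "inverse_on (expos_upto r) (moment_matrix y) (\<alpha>, \<beta>) (\<alpha>', \<beta>') = 0"
    using deg gl_le_tdeg[OF le]
    by (subst inverse_moment_matrix[OF pd]) (auto simp: expos_upto_def intro!: sum.neutral)
qed

text \<open>Taking \<open>r\<close> to be the degree of \<open>a\<close> keeps every index of degree
  at most \<open>r\<close> above \<open>a\<close> in the same degree. Induction on the number of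
  such indices starts from the largest one.\<close>

lemma zero_in_inverse_imp_rho_eq_0:
  assumes pd: "pos_def_on (expos_upto r) (moment_matrix y)"
    and zi: "zero_in_inverse y r"
    and "tdeg a = r" "b \<le>\<^sub>g\<^sub>l a" "\<not> snd b \<le> snd a"
  shows "rho y a b = 0"
  using assms(3-)
proof (induction "card {c \<in> expos_upto r. a <\<^sub>g\<^sub>l c}" arbitrary: a b rule: less_induct)
  case less
  note deg = less.prems(1) and le = less.prems(2) and nle = less.prems(3)
  \<comment> \<open>Here |\<open>snd c\<close>| \<le> |\<open>snd a\<close>|, so
    \<open>snd a \<le> snd c\<close> forces equality, and then \<open>snd b \<le> snd c\<close>
    contradicts \<open>nle\<close>.\<close>
  have no_ub: "\<not> (snd a \<le> snd c \<and> snd b \<le> snd c)" if "a \<le>\<^sub>g\<^sub>l c" "tdeg c \<le> r" for c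
    using vdeg_le_imp_eq[of "snd a" "snd c"] gl_le_vdeg_snd[OF that(1)] that(2) deg nle by auto
  have "inverse_on (expos_upto r) (moment_matrix y) a b = 0"
  proof -
    obtain \<alpha> \<beta> where a: "a = (\<alpha>, \<beta>)" by (cases a)
    obtain \<alpha>' \<beta>' where b: "b = (\<alpha>', \<beta>')" by (cases b)
    show ?thesis
      using zi deg le no_ub unfolding zero_in_inverse_def a b vmax_le_iff
      by (metis linorder_not_less order_refl snd_conv)
  qed
  then have "0 = (\<Sum>c\<in>expos_upto r. rho y c a * rho y c b)"
    using deg gl_le_tdeg[OF le] by (subst (asm) inverse_moment_matrix[OF pd]) (auto simp: expos_upto_def)
  also have "\<dots> = (\<Sum>c\<in>{a}. rho y c a * rho y c b)"
  proof (rule sum.mono_neutral_right[OF finite_expos_upto])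
    show "\<forall>c\<in>expos_upto r - {a}. rho y c a * rho y c b = 0"
    proof (rule ballI, rule ccontr)
      fix c
      assume c: "c \<in> expos_upto r - {a}" and nz: "rho y c a * rho y c b \<noteq> 0"
      then have ac: "a \<le>\<^sub>g\<^sub>l c" "b \<le>\<^sub>g\<^sub>l c" using rho_eq_0[of a c y] rho_eq_0[of b c y] by auto
      then have lt: "a <\<^sub>g\<^sub>l c" using c by (auto simp: gl_le_def)
      have deg_c: "tdeg c = r"
        using c deg gl_le_tdeg[OF ac(1)] by (auto simp: expos_upto_def)
      have "card {e \<in> expos_upto r. c <\<^sub>g\<^sub>l e} < card {e \<in> expos_upto r. a <\<^sub>g\<^sub>l e}"
      proof (rule psubset_card_mono)
        show "{e \<in> expos_upto r. c <\<^sub>g\<^sub>l e} \<subset> {e \<in> expos_upto r. a <\<^sub>g\<^sub>l e}"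
          using c lt gl_less_trans[OF lt] gl_less_irrefl[of c] by blast
      qed (simp add: finite_expos_upto)
      then have IH: "e \<le>\<^sub>g\<^sub>l c \<Longrightarrow> \<not> snd e \<le> snd c \<Longrightarrow> rho y c e = 0" for e
        using less.hyps[of c e] deg_c by blast
      \<comment> \<open>The induction hypothesis at \<open>c\<close> is used for both factors, once
        with \<open>e = a\<close> and once with \<open>e = b\<close>.\<close>
      have "snd a \<le> snd c" "snd b \<le> snd c"
        using IH[OF ac(1)] IH[OF ac(2)] nz by auto
      then show False using no_ub[OF ac(1)] deg_c by simp
    qed
  qed (use deg in \<open>simp add: expos_upto_def\<close>)
  finally show ?case using rho_diag_neq_0[OF pd, of a] deg by simp
qed

theorem theorem6p1:
  fixes y :: "(nat ^ 'n::{finite,linorder}) \<times> (nat ^ 'm::{finite,linorder}) \<Rightarrow> real"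
    and d :: nat
  assumes "d \<ge> 1"
    and "pos_def_on (expos_upto d) (moment_matrix y)"
  shows "(\<forall>r. 1 \<le> r \<and> r \<le> d \<longrightarrow> zero_in_inverse y r) \<longleftrightarrow> cond_triangular y d"
proof -
  have pd: "pos_def_on (expos_upto r) (moment_matrix y)" if "r \<le> d" for r
    by (rule pos_def_on_subset[OF assms(2)]) (use that finite_expos_upto in \<open>auto simp: expos_upto_def\<close>)
  show ?thesis
  proof (intro iffI allI impI)
    assume zi: "\<forall>r. 1 \<le> r \<and> r \<le> d \<longrightarrow> zero_in_inverse y r"
    show "cond_triangular y d"
      unfolding cond_triangular_def
    proof (intro allI impI)
      fix \<alpha> \<alpha>' :: "(nat, 'n) vec" and \<beta> \<beta>' :: "(nat, 'm) vec"
      assume deg: "tdeg (\<alpha>, \<beta>) \<le> d" and le: "(\<alpha>', \<beta>') \<le>\<^sub>g\<^sub>l (\<alpha>, \<beta>)" and nle: "\<not> \<beta>' \<le> \<beta>"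
      \<comment> \<open>The assumption \<open>zi\<close> starts at \<open>r = 1\<close>; in degree 0
        one has \<beta>' = 0 \<le> \<beta>, so nothing is claimed there.\<close>
      have "tdeg (\<alpha>, \<beta>) \<noteq> 0"
      proof
        assume "tdeg (\<alpha>, \<beta>) = 0"
        then have "vdeg \<beta>' = 0" using gl_le_tdeg[OF le] by (simp add: tdeg_def)
        then show False using nle by (simp add: vdeg_def less_eq_vec_def)
      qed
      then show "rho y (\<alpha>, \<beta>) (\<alpha>', \<beta>') = 0"
        using zi deg le nle
        by (intro zero_in_inverse_imp_rho_eq_0[OF pd, where r = "tdeg (\<alpha>, \<beta>)"]) auto
    qed
  next
    fix r
    assume "cond_triangular y d" "1 \<le> r \<and> r \<le> d"
    then have "cond_triangular y r" by (simp add: cond_triangular_def)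
    then show "zero_in_inverse y r"
      using \<open>1 \<le> r \<and> r \<le> d\<close> by (intro cond_triangular_imp_zero_in_inverse pd) auto
  qed
qed

end
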